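(* Let $q=p^r$ be a power of a prime $p$, let $d\ge 1$, and let $M\in\mathbb{F}_q[T]$ be a nonzero polynomial which splits into linear factors over $\mathbb{F}_{q^d}$. Then, inside a fixed algebraic closure of $\mathbb{F}_q(T)$, the cyclotomic function fields satisfy $K_{q,M}\subset K_{q^d,M}$.
   Context: For a power $Q$ of $p$ (here $Q=q$ or $Q=q^d$), the Carlitz action over $\mathbb{F}_Q$ is defined on $u\in\overline{\mathbb{F}_q(T)}$ by $C_Q(T)(u)=Tu+u^{Q}$, extended $\mathbb{F}_Q$-linearly to all $N=\sum a_iT^i\in\mathbb{F}_Q[T]$ by $C_Q(N)(u)=\sum a_i C_Q(T)^{i}(u)$, where $C_Q(T)^i$ denotes the $i$-fold composite. The $N$-torsion $C_Q[N]$ is the set of $u\in\overline{\mathbb{F}_q(T)}$ with $C_Q(N)(u)=0$. The cyclotomic function field $K_{Q,N}$ is the field obtained by adjoining $C_Q[N]$ to $\mathbb{F}_Q(T)$. *)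

theory Defs
  imports "HOL-Computational_Algebra.Computational_Algebra"
begin

text \<open>We work inside an algebraically closed field 'a (standing for a fixed algebraic
closure of F_q(T)), with a distinguished element t playing the role of the
indeterminate T.\<close>

text \<open>The subfield F_Q = {x. x ^ Q = x} of 'a (for Q a power of the characteristic).\<close>
definition finite_subfield :: "nat \<Rightarrow> 'a::field set" where
  "finite_subfield Q = {x. x ^ Q = x}"

definition is_subfield :: "'a::field set \<Rightarrow> bool" where
  "is_subfield F \<longleftrightarrow> 0 \<in> F \<and> 1 \<in> F \<and> (\<forall>x\<in>F. \<forall>y\<in>F. x + y \<in> F \<and> x * y \<in> F)
     \<and> (\<forall>x\<in>F. - x \<in> F \<and> inverse x \<in> F)"

definition gen_field :: "'a::field set \<Rightarrow> 'a set" where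
  "gen_field S = \<Inter>{F. S \<subseteq> F \<and> is_subfield F}"

definition carlitz_T :: "nat \<Rightarrow> 'a::field \<Rightarrow> 'a \<Rightarrow> 'a" where
  "carlitz_T Q t u = t * u + u ^ Q"

text \<open>Carlitz action of N = sum a_i T^i (a polynomial with coefficients in F_Q, viewed as
a polynomial in the indeterminate T): C_Q(N)(u) = sum a_i C_Q(T)^i(u).\<close>
definition carlitz :: "nat \<Rightarrow> 'a::field \<Rightarrow> 'a poly \<Rightarrow> 'a \<Rightarrow> 'a" where
  "carlitz Q t N u = (\<Sum>i\<le>degree N. coeff N i * (carlitz_T Q t ^^ i) u)"

definition carlitz_torsion :: "nat \<Rightarrow> 'a::field \<Rightarrow> 'a poly \<Rightarrow> 'a set" where
  "carlitz_torsion Q t N = {u. carlitz Q t N u = 0}"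

definition cyclotomic_field :: "nat \<Rightarrow> 'a::field \<Rightarrow> 'a poly \<Rightarrow> 'a set" where
  "cyclotomic_field Q t N = gen_field (finite_subfield Q \<union> {t} \<union> carlitz_torsion Q t N)"

end

theory Submission
  imports Defs
begin

text \<open>
  Let \<open>u\<close> be an \<open>M\<close>-torsion point of \<open>C\<^sub>q\<close>, let \<open>\<ell>\<close> be the linear functional on polynomials with
  \<open>\<ell>(T\<^sup>i) = C\<^sub>q(T)\<^sup>i(u)\<close>, and let \<open>\<sigma>\<close> raise coefficients to the power \<open>q\<close>. Then \<open>\<ell>(M) = 0\<close> and
  \<open>\<ell>(P)\<^sup>q = \<ell>((T - t) \<sigma>P)\<close>. If \<open>(T - a)\<^sup>n\<close> divides \<open>M\<close>, collect the values \<open>\<ell>(M / (T - a)\<^bsup>k+1\<^esup>)\<close> for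
  \<open>k < n\<close> as the coefficients of \<open>\<epsilon>\<^sup>k\<close> in a power series \<open>X\<^sub>a\<close>. Since \<open>\<sigma>M = M\<close>, we get
  \<open>\<sigma>X\<^sub>a \<equiv> (a\<^sup>q - t + \<epsilon>) X\<^sub>b\<close> modulo \<open>\<epsilon>\<^sup>n\<close>, where \<open>b = a\<^sup>q\<close>.

  Let \<open>Y\<^sub>a\<close> be an invertible power series with \<open>\<sigma>\<^sup>d Y\<^sub>a = (a - t + \<epsilon>) Y\<^sub>a\<close>. Its first \<open>n\<close> coefficients are
  \<open>M\<close>-torsion points of the Carlitz action over the field with \<open>q\<^sup>d\<close> elements. Let \<open>Z\<^sub>a\<close> be the product of
  the \<open>\<sigma>\<^sup>i Y\<^sub>c\<close> over \<open>i < d\<close>, where \<open>c\<close> is the conjugate of \<open>a\<close> with \<open>\<sigma>\<^sup>i c = a\<close>. It satisfies the same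
  equation as \<open>X\<^sub>a\<close>, so \<open>X\<^sub>a / Z\<^sub>a\<close> is fixed by \<open>\<sigma>\<^sup>d\<close> modulo \<open>\<epsilon>\<^sup>n\<close> and its first \<open>n\<close> coefficients lie in
  that finite field. (For \<open>n = 1\<close> this is the factorization of Thakur's Gauss sums.) Hence all
  \<open>\<ell>(M / (T - a)\<^bsup>k+1\<^esup>)\<close> lie in the larger cyclotomic field, and by partial fractions so does
  \<open>u = \<ell>(1)\<close>.
\<close>

section \<open>Subfields\<close>

lemma is_subfield_gen_field: "is_subfield (gen_field S)"
  unfolding is_subfield_def gen_field_def by auto

lemma is_subfield_cyclotomic_field: "is_subfield (cyclotomic_field Q t N)"
  unfolding cyclotomic_field_def by (rule is_subfield_gen_field)

lemma finite_subfield_subset_cyclotomic_field: "finite_subfield Q \<subseteq> cyclotomic_field Q t N"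
  and generator_in_cyclotomic_field: "t \<in> cyclotomic_field Q t N"
  and carlitz_torsion_subset_cyclotomic_field: "carlitz_torsion Q t N \<subseteq> cyclotomic_field Q t N"
  unfolding cyclotomic_field_def gen_field_def by auto

lemma gen_field_minimal: "S \<subseteq> F \<Longrightarrow> is_subfield F \<Longrightarrow> gen_field S \<subseteq> F"
  unfolding gen_field_def by auto

context
  fixes F :: "'a::field set"
  assumes F: "is_subfield F"
begin

lemma subfield_0: "0 \<in> F" and subfield_1: "1 \<in> F"
  and subfield_add: "x \<in> F \<Longrightarrow> y \<in> F \<Longrightarrow> x + y \<in> F"
  and subfield_mult: "x \<in> F \<Longrightarrow> y \<in> F \<Longrightarrow> x * y \<in> F"
  and subfield_uminus: "x \<in> F \<Longrightarrow> - x \<in> F"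
  and subfield_inverse: "x \<in> F \<Longrightarrow> inverse x \<in> F"
  using F unfolding is_subfield_def by auto

lemma subfield_diff: "x \<in> F \<Longrightarrow> y \<in> F \<Longrightarrow> x - y \<in> F"
  using subfield_add[of x "- y"] subfield_uminus[of y] by simp

lemma subfield_power: "x \<in> F \<Longrightarrow> x ^ n \<in> F"
  by (induction n) (auto intro: subfield_1 subfield_mult)

lemma subfield_sum: "(\<And>i. i \<in> A \<Longrightarrow> f i \<in> F) \<Longrightarrow> sum f A \<in> F"
  by (induction A rule: infinite_finite_induct) (auto intro: subfield_0 subfield_add)

lemma subfield_mult_cancel_left:
  assumes "c * x \<in> F" "c \<in> F" "c \<noteq> 0"
  shows "x \<in> F"
proof -
  have "inverse c * (c * x) \<in> F"
    by (rule subfield_mult[OF subfield_inverse[OF assms(2)] assms(1)])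
  then show ?thesis
    using assms(3) by (simp flip: mult.assoc)
qed

end

lemma finite_subfield_power_subset: "finite_subfield q \<subseteq> finite_subfield (q ^ d)"
proof (induction d)
  case (Suc d)
  then show ?case by (auto simp: finite_subfield_def power_mult)
qed (auto simp: finite_subfield_def)

lemma finite_subfield_power_closed:
  "x \<in> finite_subfield Q \<Longrightarrow> x ^ k \<in> finite_subfield Q"
  by (simp add: finite_subfield_def flip: power_mult) (metis mult.commute power_mult)

section \<open>Powers of the characteristic\<close>

text \<open>Packs the hypotheses of the freshman's dream, so that \<open>q\<close> and
  \<open>q ^ d\<close> are treated alike.\<close>

definition char_power :: "'a::field itself \<Rightarrow> nat \<Rightarrow> bool" where
  "char_power _ Q \<longleftrightarrow> prime CHAR('a) \<and> (\<exists>m. Q = CHAR('a) ^ m)"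

context
  fixes Q :: nat
  assumes Q: "char_power TYPE('a::field) Q"
begin

lemma char_power_pos: "Q > 0"
  using Q prime_gt_0_nat unfolding char_power_def by auto

lemma add_power_char: "(x + y :: 'a) ^ Q = x ^ Q + y ^ Q"
  using Q freshmans_dream' unfolding char_power_def by blast

lemma sum_power_char: "(\<Sum>i\<in>A. f i :: 'a) ^ Q = (\<Sum>i\<in>A. f i ^ Q)"
  using Q freshmans_dream_sum' unfolding char_power_def by blast

lemma uminus_power_char: "(- x :: 'a) ^ Q = - (x ^ Q)"
  using add_power_char[of x "- x"] char_power_pos by (simp add: eq_neg_iff_add_eq_0 add.commute zero_power)

lemma char_power_power: "char_power TYPE('a) (Q ^ k)"
  using Q unfolding char_power_def by (metis power_mult)

end

section \<open>The Carlitz action\<close>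

lemma carlitz_eq_sum:
  assumes "degree N \<le> n"
  shows "carlitz Q t N u = (\<Sum>i\<le>n. coeff N i * (carlitz_T Q t ^^ i) u)"
  unfolding carlitz_def
  by (rule sum.mono_neutral_left) (use assms in \<open>auto simp: coeff_eq_0\<close>)

lemma carlitz_0 [simp]: "carlitz Q t 0 u = 0"
  by (simp add: carlitz_def)

lemma carlitz_pCons:
  "carlitz Q t (pCons a N) u = a * u + carlitz Q t N (carlitz_T Q t u)"
proof -
  have "carlitz Q t (pCons a N) u =
      (\<Sum>i\<le>Suc (degree N). coeff (pCons a N) i * (carlitz_T Q t ^^ i) u)"
    by (intro carlitz_eq_sum degree_pCons_le)
  also have "\<dots> = a * u + (\<Sum>i\<le>degree N. coeff N i * (carlitz_T Q t ^^ i) (carlitz_T Q t u))"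
    by (subst sum.atMost_Suc_shift) (simp add: funpow_swap1)
  finally show ?thesis
    by (simp add: carlitz_def)
qed

lemma carlitz_add: "carlitz Q t (N + P) u = carlitz Q t N u + carlitz Q t P u"
  by (simp add: carlitz_eq_sum[of N "max (degree N) (degree P)"]
      carlitz_eq_sum[of P "max (degree N) (degree P)"]
      carlitz_eq_sum[of "N + P" "max (degree N) (degree P)"] degree_add_le
      sum.distrib algebra_simps)

lemma carlitz_smult: "carlitz Q t (smult c N) u = c * carlitz Q t N u"
  by (simp add: carlitz_eq_sum[of _ "degree N"] degree_smult_le sum_distrib_left mult_ac)

lemma carlitz_diff: "carlitz Q t (N - P) u = carlitz Q t N u - carlitz Q t P u"
  using carlitz_add[of Q t N "smult (-1) P" u] carlitz_smult[of Q t "-1" P u] by simp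

text \<open>Rests on linearity in the polynomial alone; below, \<open>b\<close> is either a root of
  \<open>M\<close> or \<open>t\<close> itself.\<close>

lemma carlitz_linear_mult:
  "carlitz Q t ([:- b, 1:] * N) u = carlitz Q t N (carlitz_T Q t u) - b * carlitz Q t N u"
proof -
  have "[:- b, 1:] * N = pCons 0 N - smult b N"
    by simp
  then show ?thesis
    by (simp only: carlitz_diff carlitz_smult carlitz_pCons) simp
qed

context
  fixes Q :: nat
  assumes Q: "char_power TYPE('a::field) Q"
begin

lemma carlitz_T_add: "carlitz_T Q t (u + v :: 'a) = carlitz_T Q t u + carlitz_T Q t v"
  by (simp add: carlitz_T_def add_power_char[OF Q] algebra_simps)

lemma carlitz_T_mult:
  "c \<in> finite_subfield Q \<Longrightarrow> carlitz_T Q t (c * u :: 'a) = c * carlitz_T Q t u"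
  by (simp add: carlitz_T_def finite_subfield_def power_mult_distrib algebra_simps)

lemma carlitz_arg_add: "carlitz Q t N (u + v :: 'a) = carlitz Q t N u + carlitz Q t N v"
  by (induction N arbitrary: u v) (simp_all add: carlitz_pCons carlitz_T_add algebra_simps)

lemma carlitz_arg_mult:
  "c \<in> finite_subfield Q \<Longrightarrow> carlitz Q t N (c * u :: 'a) = c * carlitz Q t N u"
  by (induction N arbitrary: u) (simp_all add: carlitz_pCons carlitz_T_mult distrib_left mult.left_commute)

lemma carlitz_arg_0: "carlitz Q t N (0 :: 'a) = 0"
  using carlitz_arg_add[of t N 0 0] by (simp only: add_0_right add_cancel_right_right)

text \<open>\<open>T - b\<close> sends \<open>y k\<close> to \<open>y (k - 1)\<close> and kills
  \<open>y 0\<close>, so the \<open>y k\<close> form a Jordan chain and more than \<open>k\<close>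
  factors annihilate \<open>y k\<close>.\<close>

lemma carlitz_chain_eq_0:
  fixes y :: "nat \<Rightarrow> 'a"
  assumes b: "b \<in> finite_subfield Q"
    and y: "\<And>k. carlitz_T Q t (y k) = b * y k + (if k = 0 then 0 else y (k - 1))"
    and "k < m"
  shows "carlitz Q t ([:- b, 1:] ^ m * N) (y k) = 0"
  using \<open>k < m\<close>
proof (induction m arbitrary: k)
  case (Suc m)
  let ?P = "[:- b, 1:] ^ m * N"
  have "carlitz Q t ([:- b, 1:] ^ Suc m * N) (y k) = carlitz Q t ([:- b, 1:] * ?P) (y k)"
    by (simp only: power_Suc mult.assoc)
  also have "\<dots> = carlitz Q t ?P (if k = 0 then 0 else y (k - 1))"
    by (simp only: carlitz_linear_mult y carlitz_arg_add carlitz_arg_mult[OF b]) simp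
  also have "\<dots> = 0"
    using Suc by (auto simp: carlitz_arg_0)
  finally show ?case .
qed simp

text \<open>Since \<open>u ^ Q\<close> is \<open>carlitz_T Q t u - t * u\<close>, Frobenius turns
  into multiplication by \<open>T - t\<close> on the polynomial side.\<close>

lemma carlitz_power:
  "carlitz Q t N (u :: 'a) ^ Q = carlitz Q t ([:- t, 1:] * map_poly (\<lambda>x. x ^ Q) N) u"
proof (induction N arbitrary: u)
  case 0
  then show ?case using char_power_pos[OF Q] by simp
next
  case (pCons a N)
  let ?s = "\<lambda>x::'a. x ^ Q"
  have "u ^ Q = carlitz_T Q t u - t * u"
    by (simp add: carlitz_T_def)
  then have "carlitz Q t (pCons a N) u ^ Q =
      a ^ Q * (carlitz_T Q t u - t * u) + carlitz Q t ([:- t, 1:] * map_poly ?s N) (carlitz_T Q t u)"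
    by (simp only: carlitz_pCons add_power_char[OF Q] power_mult_distrib pCons.IH)
  also have "\<dots> = carlitz Q t ([:- t, 1:] * pCons (a ^ Q) (map_poly ?s N)) u"
    by (simp only: carlitz_linear_mult carlitz_pCons) (simp add: algebra_simps)
  finally show ?case
    using char_power_pos[OF Q] by (simp add: map_poly_pCons)
qed

lemma map_poly_power_mult:
  "map_poly (\<lambda>x::'a. x ^ Q) (N * P) = map_poly (\<lambda>x. x ^ Q) N * map_poly (\<lambda>x. x ^ Q) P"
  using char_power_pos[OF Q]
  by (intro poly_eqI) (simp add: coeff_map_poly coeff_mult sum_power_char[OF Q] power_mult_distrib)

lemma map_poly_power_linear:
  "map_poly (\<lambda>x::'a. x ^ Q) ([:- a, 1:] ^ n) = [:- (a ^ Q), 1:] ^ n"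
proof (induction n)
  case 0
  then show ?case using char_power_pos[OF Q] by simp
next
  case (Suc n)
  then show ?case using char_power_pos[OF Q]
    by (simp only: power_Suc map_poly_power_mult) (simp add: map_poly_pCons uminus_power_char[OF Q])
qed

end

section \<open>Frobenius on power series\<close>

text \<open>Acts on coefficients only; the variable \<open>fps_X\<close>, the epsilon of the
  overview, is not raised to a power.\<close>

definition fps_frob :: "nat \<Rightarrow> 'a::field fps \<Rightarrow> 'a fps" where
  "fps_frob q f = Abs_fps (\<lambda>k. (f $ k) ^ q)"

lemma fps_frob_nth [simp]: "fps_frob q f $ k = (f $ k) ^ q"
  by (simp add: fps_frob_def)

lemma fps_frob_Suc_0 [simp]: "fps_frob (Suc 0) f = f"
  by (simp add: fps_eq_iff)

lemma fps_frob_fps_frob: "fps_frob q (fps_frob r f) = fps_frob (r * q) f"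
  by (simp add: fps_eq_iff power_mult)

context
  fixes q :: nat
  assumes q: "char_power TYPE('a::field) q"
begin

lemma fps_frob_mult: "fps_frob q (f * g :: 'a fps) = fps_frob q f * fps_frob q g"
  by (simp add: fps_eq_iff fps_mult_nth sum_power_char[OF q] power_mult_distrib)

lemma fps_frob_one: "fps_frob q (1 :: 'a fps) = 1"
  using char_power_pos[OF q] by (simp add: fps_eq_iff)

lemma fps_frob_prod: "fps_frob q (\<Prod>i\<in>A. f i :: 'a fps) = (\<Prod>i\<in>A. fps_frob q (f i))"
  by (induction A rule: infinite_finite_induct) (simp_all add: fps_frob_mult fps_frob_one)

end

lemma fps_linear_mult_nth:
  "((fps_const c + fps_X) * f :: 'a::field fps) $ k = c * f $ k + (if k = 0 then 0 else f $ (k - 1))"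
  by (simp add: distrib_right)

text \<open>Turns congruence up to order \<open>n\<close> into divisibility, where unit factors can
  be cancelled.\<close>

lemma fps_X_power_dvd_iff: "fps_X ^ n dvd (f :: 'a::field fps) \<longleftrightarrow> (\<forall>k<n. f $ k = 0)"
proof
  assume "fps_X ^ n dvd f"
  then show "\<forall>k<n. f $ k = 0"
    by (auto simp: fps_X_power_mult_nth elim!: dvdE)
next
  assume "\<forall>k<n. f $ k = 0"
  then have "f = fps_X ^ n * fps_shift n f"
    by (intro fps_ext) (simp add: fps_X_power_mult_nth)
  then show "fps_X ^ n dvd f"
    by (rule dvdI)
qed

lemma exists_artin_schreier_root:
  fixes a c :: "'a::alg_closed_field"
  assumes "Q > 1"
  shows "\<exists>y. y ^ Q = a * y + c"
proof -
  define P where "P = monom 1 Q - [:c, a:]"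
  have "coeff P Q = 1"
    using assms by (auto simp: P_def coeff_pCons split: nat.splits)
  then have "degree P > 0"
    using assms le_degree[of P Q] by auto
  then obtain y where "poly P y = 0"
    using alg_closed_imp_poly_has_root by blast
  then show ?thesis
    by (auto simp: P_def poly_monom algebra_simps intro!: exI[of _ y])
qed

text \<open>Comparing coefficients leaves one equation \<open>y ^ Q = a * y + c\<close> per degree,
  with \<open>c\<close> the preceding coefficient.\<close>

lemma exists_fps_frob_eigenvector:
  fixes a :: "'a::alg_closed_field"
  assumes "Q > 1" and "a \<noteq> 0"
  shows "\<exists>Y. Y $ 0 \<noteq> 0 \<and> fps_frob Q Y = (fps_const a + fps_X) * Y"
proof -
  \<comment> \<open>A root of order \<open>Q - 1\<close> is a nonzero solution in degree 0, which
    makes the series invertible.\<close>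
  obtain y0 where y0: "y0 ^ (Q - 1) = a"
    using nth_root_exists[of "Q - 1" a] assms(1) by auto
  have "y0 \<noteq> 0"
    using y0 assms by (auto simp: power_0_left)
  have y0': "y0 ^ Q = a * y0"
    using y0 assms(1) by (metis One_nat_def Suc_pred less_trans mult.commute power_Suc zero_less_one)
  have "\<exists>y. \<forall>k. (k = 0 \<longrightarrow> y k = y0) \<and> y (Suc k) ^ Q = a * y (Suc k) + y k"
    by (rule dependent_nat_choice) (use exists_artin_schreier_root[OF assms(1)] in auto)
  then obtain y where y: "y 0 = y0" "\<And>k. y (Suc k) ^ Q = a * y (Suc k) + y k"
    by blast
  have "fps_frob Q (Abs_fps y) = (fps_const a + fps_X) * Abs_fps y"
  proof (rule fps_ext)
    fix k
    show "fps_frob Q (Abs_fps y) $ k = ((fps_const a + fps_X) * Abs_fps y) $ k"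
      using y y0' by (cases k) (simp_all only: fps_linear_mult_nth, simp_all)
  qed
  then show ?thesis
    using y(1) \<open>y0 \<noteq> 0\<close> by (intro exI[of _ "Abs_fps y"]) simp
qed

text \<open>Isolates the Frobenius argument from torsion: \<open>x b k\<close> are the coefficients
  of the series for the root \<open>b\<close>, and \<open>K\<close> is any field with the constants
  and the first \<open>n\<close> coefficients of all eigenvectors.\<close>

lemma frob_system_solution_in_subfield:
  fixes x :: "'a::alg_closed_field \<Rightarrow> nat \<Rightarrow> 'a"
  assumes q: "char_power TYPE('a) q" "q > 1" and d: "d \<ge> 1"
    and B: "B \<subseteq> finite_subfield (q ^ d)" "\<And>b. b \<in> B \<Longrightarrow> b ^ q \<in> B" "t \<notin> B"
    and x: "\<And>b k. b \<in> B \<Longrightarrow> k < n \<Longrightarrow>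
        x b k ^ q = (b ^ q - t) * x (b ^ q) k + (if k = 0 then 0 else x (b ^ q) (k - 1))"
    and K: "is_subfield K" "finite_subfield (q ^ d) \<subseteq> K"
    and Y: "\<And>b Y k. b \<in> B \<Longrightarrow> fps_frob (q ^ d) Y = (fps_const (b - t) + fps_X) * Y \<Longrightarrow>
        k < n \<Longrightarrow> Y $ k \<in> K"
    and a: "a \<in> B" and k: "k < n"
  shows "x a k \<in> K"
proof -
  define Q where "Q = q ^ d"
  have Q1: "Q > 1"
    unfolding Q_def using q(2) d by (intro one_less_power) auto
  have Bpow: "b ^ (q ^ i) \<in> B" if "b \<in> B" for b i
    using that by (induction i) (auto simp: power_Suc2 power_mult simp del: power_Suc intro: B(2))
  have "\<exists>V. \<forall>b\<in>B. V b $ 0 \<noteq> 0 \<and> fps_frob Q (V b) = (fps_const (b - t) + fps_X) * V b"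
    by (intro bchoice ballI exists_fps_frob_eigenvector) (use Q1 B(3) in auto)
  then obtain V where V0: "\<And>b. b \<in> B \<Longrightarrow> V b $ 0 \<noteq> 0"
    and V: "\<And>b. b \<in> B \<Longrightarrow> fps_frob Q (V b) = (fps_const (b - t) + fps_X) * V b"
    by blast

  \<comment> \<open>\<open>b ^ (q ^ (d - i))\<close> is the conjugate whose \<open>q ^ i\<close>-th
    power is \<open>b\<close>, because \<open>b ^ (q ^ d) = b\<close>.\<close>
  define Z where "Z b = (\<Prod>i<d. fps_frob (q ^ i) (V (b ^ (q ^ (d - i)))))" for b
  have Z0: "Z b $ 0 \<noteq> 0" if "b \<in> B" for b
  proof -
    have "(\<Prod>i\<in>A. fps_frob (q ^ i) (V (b ^ (q ^ (d - i))))) $ 0 \<noteq> 0" for A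
      by (induction A rule: infinite_finite_induct) (simp_all add: V0 Bpow that)
    then show ?thesis
      by (simp add: Z_def)
  qed
  have Z: "fps_frob q (Z b) = (fps_const (b ^ q - t) + fps_X) * Z (b ^ q)" if b: "b \<in> B" for b
  proof -
    \<comment> \<open>\<open>fps_frob q (Z b)\<close> is the product of \<open>f 1\<close> to
      \<open>f d\<close>, and \<open>Z (b ^ q)\<close> that of \<open>f 0\<close> to
      \<open>f (d - 1)\<close>; only the end factors differ.\<close>
    define f where "f i = fps_frob (q ^ i) (V (b ^ (q ^ (Suc d - i))))" for i
    have "(b ^ q) ^ Q = b ^ q"
      using B(1,2) b unfolding finite_subfield_def Q_def by blast
    then have f0: "f 0 = V (b ^ q)"
      by (simp add: f_def Q_def power_mult)
    have fd: "f d = (fps_const (b ^ q - t) + fps_X) * f 0"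
      using V[OF B(2)[OF b]] by (simp add: f0) (simp add: f_def Q_def Suc_diff_le)
    have "fps_frob q (Z b) = (\<Prod>i<d. f (Suc i))"
      by (simp add: Z_def fps_frob_prod[OF q(1)] f_def fps_frob_fps_frob mult.commute)
    moreover have "Z (b ^ q) = (\<Prod>i<d. f i)"
      unfolding Z_def f_def
      by (intro prod.cong) (simp_all add: Suc_diff_le flip: power_mult)
    moreover have "(\<Prod>i<d. f (Suc i)) * f 0 = (\<Prod>i<d. f i) * f d"
      using prod.lessThan_Suc_shift[of f d] prod.lessThan_Suc[of f d] by (simp add: mult.commute)
    moreover have "f 0 \<noteq> 0"
      using V0[OF B(2)[OF b]] by (auto simp: f0)
    ultimately show ?thesis
      unfolding fd by (simp add: mult_ac)
  qed
  have ZK: "Z b $ k \<in> K" if b: "b \<in> B" and "k < n" for b k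
  proof -
    have "(\<Prod>i\<in>A. fps_frob (q ^ i) (V (b ^ (q ^ (d - i))))) $ k \<in> K" for A
      using \<open>k < n\<close>
    proof (induction A arbitrary: k rule: infinite_finite_induct)
      case (insert j A)
      have "fps_frob (q ^ j) (V (b ^ (q ^ (d - j)))) $ i \<in> K" if "i \<le> k" for i
        using Y[OF Bpow[OF b] V[OF Bpow[OF b], unfolded Q_def], of i "d - j"] that insert.prems
        by (auto intro: subfield_power[OF K(1)])
      then show ?case
        using insert
        by (simp add: fps_mult_nth) (auto intro!: subfield_sum[OF K(1)] subfield_mult[OF K(1)])
    qed (auto simp: subfield_0[OF K(1)] subfield_1[OF K(1)])
    then show ?thesis
      by (simp add: Z_def)
  qed

  \<comment> \<open>The recursion is known only below \<open>n\<close>, so the series is cut off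
    there and compared modulo \<open>fps_X ^ n\<close>.\<close>
  define X where "X b = Abs_fps (\<lambda>k. if k < n then x b k else 0)" for b
  define G where "G b = X b * inverse (Z b)" for b
  have XG: "X b = G b * Z b" if "b \<in> B" for b
    using Z0[OF that] by (simp add: G_def mult.assoc inverse_mult_eq_1)
  have X: "fps_X ^ n dvd fps_frob q (X b) - (fps_const (b ^ q - t) + fps_X) * X (b ^ q)"
    if "b \<in> B" for b
    unfolding fps_X_power_dvd_iff fps_sub_nth fps_linear_mult_nth
    using that by (auto simp: X_def x)
  have G: "(G b $ k) ^ q = G (b ^ q) $ k" if b: "b \<in> B" and "k < n" for b k
  proof -
    define E where "E = (fps_const (b ^ q - t) + fps_X) * Z (b ^ q)"
    have "fps_frob q (X b) - (fps_const (b ^ q - t) + fps_X) * X (b ^ q) =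
        (fps_frob q (G b) - G (b ^ q)) * E"
      by (simp add: XG b B(2) fps_frob_mult[OF q(1)] Z E_def algebra_simps)
    \<comment> \<open>The constant term of \<open>E\<close> is nonzero since \<open>b ^ q\<close>
      lies in \<open>B\<close> and \<open>t\<close> does not.\<close>
    moreover have "E dvd 1"
      using Z0 B(2,3) b by (auto simp: E_def)
    ultimately have "fps_X ^ n dvd fps_frob q (G b) - G (b ^ q)"
      using X[OF b] by (simp add: dvd_mult_unit_iff)
    then show ?thesis
      using \<open>k < n\<close> by (simp add: fps_X_power_dvd_iff)
  qed
  have "(G b $ k) ^ (q ^ i) = G (b ^ (q ^ i)) $ k" if "b \<in> B" "k < n" for b k i
    using that
    by (induction i) (auto simp: power_Suc2 power_mult G Bpow simp del: power_Suc)
  \<comment> \<open>Taking \<open>i = d\<close> brings the conjugate back to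
    \<open>a\<close>.\<close>
  then have "G a $ k \<in> finite_subfield (q ^ d)" if "k < n" for k
    using that a B(1) by (auto simp: finite_subfield_def)
  then have "(G a * Z a) $ k \<in> K"
    using k K(2) ZK[OF a] unfolding fps_mult_nth
    by (intro subfield_sum[OF K(1)] subfield_mult[OF K(1)]) auto
  then show ?thesis
    using k by (simp add: X_def flip: XG[OF a])
qed

section \<open>Torsion points\<close>

lemma carlitz_prime_power_cofactor_in_cyclotomic_field:
  fixes M N :: "'a::alg_closed_field poly"
  assumes q: "char_power TYPE('a) q" "q > 1" and d: "d \<ge> 1"
    and t: "t \<notin> finite_subfield (q ^ d)"
    and M: "\<forall>i. coeff M i \<in> finite_subfield q"
    and u: "u \<in> carlitz_torsion q t M"
    and a: "a \<in> finite_subfield (q ^ d)"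
    and MN: "M = [:- a, 1:] ^ n * N"
  shows "carlitz q t N u \<in> cyclotomic_field (q ^ d) t M"
proof (cases n)
  case 0
  then show ?thesis
    using u MN subfield_0[OF is_subfield_cyclotomic_field] by (simp add: carlitz_torsion_def)
next
  case (Suc m)
  define B where "B = {b \<in> finite_subfield (q ^ d). [:- b, 1:] ^ n dvd M}"
  define P where "P b k = M div [:- b, 1:] ^ k" for b k
  \<comment> \<open>The shift to \<open>Suc k\<close> makes index \<open>n - 1\<close> give the
    cofactor \<open>N\<close> when \<open>b = a\<close>.\<close>
  define x where "x b k = carlitz q t (P b (Suc k)) u" for b k
  have frobM: "map_poly (\<lambda>x. x ^ q) M = M"
    using M char_power_pos[OF q(1)]
    by (intro poly_eqI) (simp add: coeff_map_poly finite_subfield_def)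
  have PM: "[:- b, 1:] ^ k * P b k = M" if "b \<in> B" "k \<le> n" for b k
    using that le_imp_power_dvd[OF that(2), of "[:- b, 1:]"]
    by (auto simp: P_def B_def intro: dvd_mult_div_cancel dvd_trans)
  have frobP: "[:- (b ^ q), 1:] ^ k * map_poly (\<lambda>x. x ^ q) (P b k) = M"
    if "b \<in> B" "k \<le> n" for b k
    using arg_cong[OF PM[OF that], of "map_poly (\<lambda>x. x ^ q)"]
    by (simp add: frobM map_poly_power_mult[OF q(1)] map_poly_power_linear[OF q(1)])
  have Bq: "b ^ q \<in> B" if "b \<in> B" for b
    using frobP[OF that, of n] that finite_subfield_power_closed
    by (auto simp: B_def intro: dvdI[OF sym])
  have Pq: "map_poly (\<lambda>x. x ^ q) (P b k) = P (b ^ q) k" if "b \<in> B" "k \<le> n" for b k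
    by (simp add: P_def[of "b ^ q"] flip: frobP[OF that])
  have "x a m \<in> cyclotomic_field (q ^ d) t M"
  proof (rule frob_system_solution_in_subfield[OF q d, of B t n x])
    show "B \<subseteq> finite_subfield (q ^ d)" "\<And>b. b \<in> B \<Longrightarrow> b ^ q \<in> B" "t \<notin> B"
      using t Bq by (auto simp: B_def)
    show "a \<in> B"
      using a MN by (auto simp: B_def)
    show "m < n"
      using Suc by simp
    show "finite_subfield (q ^ d) \<subseteq> cyclotomic_field (q ^ d) t M"
      by (rule finite_subfield_subset_cyclotomic_field)
  next
    fix b k
    assume b: "b \<in> B" and "k < n"
    define c where "c = b ^ q"
    have c: "c \<in> B"
      using Bq b by (simp add: c_def)
    have "[:- c, 1:] ^ k * ([:- c, 1:] * P c (Suc k)) = [:- c, 1:] ^ k * P c k"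
      using PM[OF c, of k] PM[OF c, of "Suc k"] \<open>k < n\<close> by (simp only: power_Suc2 mult.assoc)
    then have Pc: "[:- c, 1:] * P c (Suc k) = P c k"
      by (simp only: mult_cancel_left) simp
    \<comment> \<open>Splits \<open>T - t\<close> as \<open>(T - c) + (c - t)\<close>; the first
      part lowers the exponent of the removed factor.\<close>
    have "[:- t, 1:] * P c (Suc k) = [:- c, 1:] * P c (Suc k) + smult (c - t) (P c (Suc k))"
      by (simp add: smult_diff_left)
    then have "x b k ^ q = carlitz q t (P c k) u + (c - t) * x c k"
      using Pq[OF b, of "Suc k"] \<open>k < n\<close> unfolding x_def carlitz_power[OF q(1)]
      by (simp only: c_def Suc_le_eq carlitz_add carlitz_smult Pc[unfolded c_def])
    \<comment> \<open>For \<open>k = 0\<close> the lowered cofactor is \<open>M\<close>, which kills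
      \<open>u\<close>.\<close>
    moreover have "carlitz q t (P c 0) u = 0"
      using u by (simp add: P_def carlitz_torsion_def)
    ultimately show "x b k ^ q =
        (b ^ q - t) * x (b ^ q) k + (if k = 0 then 0 else x (b ^ q) (k - 1))"
      by (simp add: c_def x_def)
  next
    fix b Y k
    assume b: "b \<in> B" and "k < n"
      and Y: "fps_frob (q ^ d) Y = (fps_const (b - t) + fps_X) * Y"
    have "(Y $ k) ^ (q ^ d) = (b - t) * Y $ k + (if k = 0 then 0 else Y $ (k - 1))" for k
      using arg_cong[OF Y, of "\<lambda>f. f $ k"] by (simp only: fps_linear_mult_nth fps_frob_nth)
    then have "carlitz_T (q ^ d) t (Y $ k) = b * Y $ k + (if k = 0 then 0 else Y $ (k - 1))" for k
      by (simp add: carlitz_T_def algebra_simps)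
    then have "carlitz (q ^ d) t ([:- b, 1:] ^ n * P b n) (Y $ k) = 0"
      using b \<open>k < n\<close> carlitz_chain_eq_0[OF char_power_power[OF q(1)], of b d t "fps_nth Y" k n]
      by (auto simp: B_def)
    then have "Y $ k \<in> carlitz_torsion (q ^ d) t M"
      using PM[OF b] by (simp add: carlitz_torsion_def)
    then show "Y $ k \<in> cyclotomic_field (q ^ d) t M"
      using carlitz_torsion_subset_cyclotomic_field by blast
  qed (rule is_subfield_cyclotomic_field)
  moreover have "P a n = N"
    by (simp add: P_def MN)
  ultimately show ?thesis
    by (simp add: x_def Suc)
qed

text \<open>Partial fractions: if the cofactor has two distinct roots \<open>a\<close> and \<open>b\<close>, then
  \<open>(b - a) N = (T - a) N - (T - b) N\<close> reduces to smaller cofactors.\<close>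

lemma carlitz_split_cofactor_in_cyclotomic_field:
  fixes M N :: "'a::alg_closed_field poly"
  assumes q: "char_power TYPE('a) q" "q > 1" and d: "d \<ge> 1"
    and t: "t \<notin> finite_subfield (q ^ d)"
    and M: "\<forall>i. coeff M i \<in> finite_subfield q"
    and u: "u \<in> carlitz_torsion q t M"
    and "set_mset A \<subseteq> finite_subfield (q ^ d)"
    and "M = (\<Prod>a\<in>#A. [:- a, 1:]) * N"
  shows "carlitz q t N u \<in> cyclotomic_field (q ^ d) t M"
  using assms(7,8)
proof (induction "size A" arbitrary: A N rule: less_induct)
  case less
  let ?K = "cyclotomic_field (q ^ d) t M"
  have K: "is_subfield ?K"
    by (rule is_subfield_cyclotomic_field)
  show ?case
  proof (cases "\<exists>a b. a \<in># A \<and> b \<in># A \<and> a \<noteq> b")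
    case True
    then obtain a b where ab: "a \<in># A" "b \<in># A" "a \<noteq> b"
      by blast
    \<comment> \<open>Moving one factor from \<open>A\<close> into the cofactor makes the multiset
      smaller.\<close>
    have step: "carlitz q t ([:- e, 1:] * N) u \<in> ?K" if e: "e \<in># A" for e
    proof (rule less.hyps[of "A - {#e#}"])
      show "size (A - {#e#}) < size A"
        using e by (simp add: size_Diff1_less)
      show "set_mset (A - {#e#}) \<subseteq> finite_subfield (q ^ d)"
        using less.prems(1) by (auto dest: in_diffD)
      obtain A' where "A = add_mset e A'"
        using e by (metis insert_DiffM)
      then show "M = (\<Prod>a\<in>#A - {#e#}. [:- a, 1:]) * ([:- e, 1:] * N)"
        unfolding less.prems(2) by (simp del: mult_pCons_left mult_pCons_right add: mult_ac)
    qed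
    have "[:- a, 1:] * N - [:- b, 1:] * N = smult (b - a) N"
      by (simp add: smult_diff_left)
    then have "(b - a) * carlitz q t N u =
        carlitz q t ([:- a, 1:] * N) u - carlitz q t ([:- b, 1:] * N) u"
      by (simp only: flip: carlitz_diff carlitz_smult)
    also have "\<dots> \<in> ?K"
      using step ab by (intro subfield_diff[OF K]) auto
    finally have "(b - a) * carlitz q t N u \<in> ?K" .
    moreover have "b - a \<in> ?K"
      using ab less.prems(1) finite_subfield_subset_cyclotomic_field
      by (intro subfield_diff[OF K]) blast+
    ultimately show ?thesis
      using ab(3) subfield_mult_cancel_left[OF K] by simp
  next
    case False
    have "\<exists>a \<in> finite_subfield (q ^ d). A = replicate_mset (size A) a"
    proof (cases "A = {#}")
      case True
      then show ?thesis
        \<comment> \<open>With exponent 0 any constant can serve as \<open>a\<close>.\<close>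
        by (intro bexI[of _ 1]) (simp_all add: finite_subfield_def)
    next
      case nonempty: False
      then obtain a where "a \<in># A"
        by blast
      then show ?thesis
        using False less.prems(1) set_mset_subset_singletonD[of A a] by blast
    qed
    then obtain a where a: "a \<in> finite_subfield (q ^ d)" "A = replicate_mset (size A) a"
      by blast
    have "M = [:- a, 1:] ^ size A * N"
      using less.prems(2) by (subst (asm) a(2)) simp
    then show ?thesis
      by (rule carlitz_prime_power_cofactor_in_cyclotomic_field[OF q d t M u a(1)])
  qed
qed

theorem theorem1p1:
  fixes p r d q :: nat and t :: "'a::alg_closed_field" and M :: "'a poly"
  assumes "prime p" and "r \<ge> 1" and "q = p ^ r" and "CHAR('a) = p"
    and "\<forall>f :: 'a poly. f \<noteq> 0 \<longrightarrow> (\<forall>i. coeff f i \<in> finite_subfield q) \<longrightarrow> poly f t \<noteq> 0"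
    and "d \<ge> 1"
    and "\<forall>i. coeff M i \<in> finite_subfield q" and "M \<noteq> 0"
    and "\<exists>c as. M = smult c (\<Prod>a\<leftarrow>as. [:- a, 1:]) \<and> set as \<subseteq> finite_subfield (q ^ d)"
  shows "cyclotomic_field q t M \<subseteq> cyclotomic_field (q ^ d) t M"
proof -
  let ?K = "cyclotomic_field (q ^ d) t M"
  have q: "char_power TYPE('a) q" "q > 1"
    using assms(1-4) one_less_power[OF prime_gt_1_nat[OF assms(1)], of r]
    by (auto simp: char_power_def)
  have K: "is_subfield ?K"
    by (rule is_subfield_cyclotomic_field)
  have gens: "finite_subfield q \<union> {t} \<subseteq> ?K"
    using finite_subfield_power_subset[of q d] finite_subfield_subset_cyclotomic_field[of "q ^ d"]
      generator_in_cyclotomic_field by blast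
  have t: "t \<notin> finite_subfield (q ^ d)"
  proof
    assume "t \<in> finite_subfield (q ^ d)"
    \<comment> \<open>\<open>T ^ (q ^ d) - T\<close> would be an algebraic relation for
      \<open>t\<close> over the constants.\<close>
    define f :: "'a poly" where "f = monom 1 (q ^ d) - monom 1 1"
    have "q ^ d > 1"
      using q(2) assms(6) by (intro one_less_power) auto
    then have "coeff f (q ^ d) = 1"
      by (simp add: f_def)
    then have "f \<noteq> 0"
      by auto
    moreover have "coeff f i \<in> finite_subfield q" for i
      using q(2) uminus_power_char[OF q(1), of 1] by (simp add: f_def finite_subfield_def)
    moreover have "poly f t = 0"
      using \<open>t \<in> finite_subfield (q ^ d)\<close> by (simp add: f_def finite_subfield_def poly_monom)
    ultimately show False
      using assms(5) by blast
  qed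
  obtain c as where as: "M = smult c (\<Prod>a\<leftarrow>as. [:- a, 1:])" "set as \<subseteq> finite_subfield (q ^ d)"
    using assms(9) by blast
  \<comment> \<open>Identifies \<open>c\<close> as the leading coefficient of \<open>M\<close>,
    hence a nonzero constant by which \<open>c * u\<close> can be divided.\<close>
  have "lead_coeff (\<Prod>a\<leftarrow>as. [:- a, 1:]) = 1"
    by (induction as) (simp_all add: lead_coeff_mult del: mult_pCons_left)
  then have "lead_coeff M = c"
    by (simp add: as(1))
  then have c: "c \<in> ?K" "c \<noteq> 0"
    using assms(7,8) gens by auto
  have "u \<in> ?K" if "u \<in> carlitz_torsion q t M" for u
  proof -
    have "carlitz q t [:c:] u \<in> ?K"
    proof (rule carlitz_split_cofactor_in_cyclotomic_field[OF q assms(6) t assms(7) that])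
      show "set_mset (mset as) \<subseteq> finite_subfield (q ^ d)"
        using as(2) by simp
      show "M = (\<Prod>a\<in>#mset as. [:- a, 1:]) * [:c:]"
        unfolding as(1) by (simp flip: prod_mset_prod_list mset_map)
    qed
    then show ?thesis
      using c subfield_mult_cancel_left[OF K] by (simp add: carlitz_pCons)
  qed
  then show ?thesis
    using gens K unfolding cyclotomic_field_def[of q] by (intro gen_field_minimal) auto
qed

end
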